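(* Let $n\ge 1$ be an integer and let $X$ be a real normed space, with norm $\|\cdot\|$, of dimension $d\ge n$. Then the $n$-dual space of $(X,\|\cdot\|)$ is $B(X,X^{(n-1)})$.
   Context: Let $X$ be a real normed space with norm $\|\cdot\|$. For an integer $k\ge 1$, a $k$-functional on $X$ is a real-valued function $f$ on $X^k$. It is multilinear if, for all $x_1,\ldots,x_k,y_1,\ldots,y_k\in X$ and $\alpha_1,\ldots,\alpha_k\in\mathbb{R}$, $$f(x_1+y_1,\ldots,x_k+y_k)=\sum_{z_i\in\{x_i,y_i\},\,1\le i\le k} f(z_1,\ldots,z_k)\quad\text{and}\quad f(\alpha_1x_1,\ldots,\alpha_kx_k)=\alpha_1\cdots\alpha_k f(x_1,\ldots,x_k).$$ It is bounded on $(X,\|\cdot\|)$ if there is a constant $K>0$ with $|f(x_1,\ldots,x_k)|\le K\|x_1\|\cdots\|x_k\|$ for all $x_1,\ldots,x_k\in X$. The $k$-dual space of $(X,\|\cdot\|)$, denoted $X^{(k)}$, is the space of bounded multilinear $k$-functionals on $(X,\|\cdot\|)$, a normed space with the norm $$\|f\|_{k,1}:=\sup_{x_1,\ldots,x_k\neq 0}\frac{|f(x_1,\ldots,x_k)|}{\|x_1\|\cdots\|x_k\|}.$$ For $k=0$, $X^{(0)}$ is defined to be $\mathbb{R}$. For real normed spaces $X,Y$, $B(X,Y)$ denotes the normed space of bounded linear operators from $X$ into $Y$ with the norm $\|u\|_{\mathrm{op}}:=\sup_{x\neq 0}\|u(x)\|/\|x\|$. The word "is" in the claim is meant in the usual sense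 of identification of normed spaces, not literal equality of sets. *)

theory Defs
  imports "HOL-Analysis.Analysis"
begin

text \<open>
  The spaces \<open>X\<^sup>(\<^sup>k\<^sup>)\<close> depend on the number \<open>k\<close>, so they cannot be
  types. They are given as explicit structures with a carrier set; the base space \<open>X\<close> itself is
  the type \<^typ>\<open>'a::real_normed_vector\<close>.
\<close>

record 'v nspace =
  carr :: "'v set"
  add :: "'v \<Rightarrow> 'v \<Rightarrow> 'v"
  zero :: "'v"
  scale :: "real \<Rightarrow> 'v \<Rightarrow> 'v"
  nrm :: "'v \<Rightarrow> real"

locale real_normed_space =
  fixes V :: "'v nspace"
  assumes zero_closed: "zero V \<in> carr V"
    and add_closed: "\<lbrakk>u \<in> carr V; v \<in> carr V\<rbrakk> \<Longrightarrow> add V u v \<in> carr V"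
    and scale_closed: "v \<in> carr V \<Longrightarrow> scale V a v \<in> carr V"
    and add_assoc: "\<lbrakk>u \<in> carr V; v \<in> carr V; w \<in> carr V\<rbrakk>
      \<Longrightarrow> add V (add V u v) w = add V u (add V v w)"
    and add_commute: "\<lbrakk>u \<in> carr V; v \<in> carr V\<rbrakk> \<Longrightarrow> add V u v = add V v u"
    and add_zero: "v \<in> carr V \<Longrightarrow> add V v (zero V) = v"
    and add_inverse: "v \<in> carr V \<Longrightarrow> \<exists>w\<in>carr V. add V v w = zero V"
    and scale_add_right: "\<lbrakk>u \<in> carr V; v \<in> carr V\<rbrakk>
      \<Longrightarrow> scale V a (add V u v) = add V (scale V a u) (scale V a v)"
    and scale_add_left: "v \<in> carr V \<Longrightarrow> scale V (a + b) v = add V (scale V a v) (scale V b v)"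
    and scale_scale: "v \<in> carr V \<Longrightarrow> scale V a (scale V b v) = scale V (a * b) v"
    and scale_one: "v \<in> carr V \<Longrightarrow> scale V 1 v = v"
    and nrm_nonneg: "v \<in> carr V \<Longrightarrow> 0 \<le> nrm V v"
    and nrm_eq_zero: "v \<in> carr V \<Longrightarrow> nrm V v = 0 \<longleftrightarrow> v = zero V"
    and nrm_scale: "v \<in> carr V \<Longrightarrow> nrm V (scale V a v) = \<bar>a\<bar> * nrm V v"
    and nrm_triangle: "\<lbrakk>u \<in> carr V; v \<in> carr V\<rbrakk> \<Longrightarrow> nrm V (add V u v) \<le> nrm V u + nrm V v"

definition isometric_isomorphism :: "'v nspace \<Rightarrow> 'w nspace \<Rightarrow> ('v \<Rightarrow> 'w) \<Rightarrow> bool" where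
  "isometric_isomorphism V W T \<longleftrightarrow>
     bij_betw T (carr V) (carr W) \<and>
     (\<forall>u\<in>carr V. \<forall>v\<in>carr V. T (add V u v) = add W (T u) (T v)) \<and>
     (\<forall>a. \<forall>v\<in>carr V. T (scale V a v) = scale W a (T v)) \<and>
     (\<forall>v\<in>carr V. nrm W (T v) = nrm V v)"

definition isometrically_isomorphic :: "'v nspace \<Rightarrow> 'w nspace \<Rightarrow> bool" (infix \<open>\<cong>\<^sub>n\<close> 50) where
  "V \<cong>\<^sub>n W \<longleftrightarrow>
     real_normed_space V \<and> real_normed_space W \<and> (\<exists>T. isometric_isomorphism V W T)"

definition real_line :: "real nspace" where
  "real_line = \<lparr>carr = UNIV, add = (+), zero = 0, scale = (*), nrm = abs\<rparr>"

text \<open>Elements of \<open>X\<^sup>k\<close> are lists of length \<open>k\<close>.\<close>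

definition tuples :: "nat \<Rightarrow> 'a list set" where
  "tuples k = {xs. length xs = k}"

text \<open>
  The sum over all \<open>z\<^sub>i \<in> {x\<^sub>i, y\<^sub>i}\<close> has \<open>2\<^sup>k\<close>
  summands, also when \<open>x\<^sub>i = y\<^sub>i\<close> for some \<open>i\<close>; it is therefore indexed by the set
  \<open>S\<close> of positions at which \<open>x\<^sub>i\<close> is chosen.
\<close>

definition multilinear :: "nat \<Rightarrow> ('a::real_vector list \<Rightarrow> real) \<Rightarrow> bool" where
  "multilinear k f \<longleftrightarrow>
     (\<forall>xs\<in>tuples k. \<forall>ys\<in>tuples k.
        f (map2 (+) xs ys) =
          (\<Sum>S\<in>Pow {..<k}. f (map (\<lambda>i. if i \<in> S then xs ! i else ys ! i) [0..<k]))) \<and>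
     (\<forall>as\<in>tuples k. \<forall>xs\<in>tuples k. f (map2 (*\<^sub>R) as xs) = prod_list as * f xs)"

definition bounded_functional :: "nat \<Rightarrow> ('a::real_normed_vector list \<Rightarrow> real) \<Rightarrow> bool" where
  "bounded_functional k f \<longleftrightarrow>
     (\<exists>K>0. \<forall>xs\<in>tuples k. \<bar>f xs\<bar> \<le> K * prod_list (map norm xs))"

text \<open>
  The \<open>k\<close>-dual space, meant for \<open>k \<ge> 1\<close>. Functions on \<open>X\<^sup>k\<close> are extensional, so that
  equality of \<open>k\<close>-functionals is equality in HOL. The space \<open>X\<^sup>(\<^sup>0\<^sup>)\<close> is \<^const>\<open>real_line\<close>,
  which lives on a different type.
\<close>

definition dual_space :: "nat \<Rightarrow> ('a::real_normed_vector list \<Rightarrow> real) nspace" where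
  "dual_space k =
     \<lparr>carr = {f \<in> extensional (tuples k). multilinear k f \<and> bounded_functional k f},
      add = (\<lambda>f g. \<lambda>xs\<in>tuples k. f xs + g xs),
      zero = (\<lambda>xs\<in>tuples k. 0),
      scale = (\<lambda>a f. \<lambda>xs\<in>tuples k. a * f xs),
      nrm = (\<lambda>f. SUP xs\<in>{xs \<in> tuples k. 0 \<notin> set xs}. \<bar>f xs\<bar> / prod_list (map norm xs))\<rparr>"

definition bounded_operators :: "'v nspace \<Rightarrow> ('a::real_normed_vector \<Rightarrow> 'v) nspace" where
  "bounded_operators Y =
     \<lparr>carr = {u. (\<forall>x. u x \<in> carr Y) \<and>
                 (\<forall>x y. u (x + y) = add Y (u x) (u y)) \<and>
                 (\<forall>a x. u (a *\<^sub>R x) = scale Y a (u x)) \<and>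
                 (\<exists>K. \<forall>x. nrm Y (u x) \<le> K * norm x)},
      add = (\<lambda>u v x. add Y (u x) (v x)),
      zero = (\<lambda>x. zero Y),
      scale = (\<lambda>a u x. scale Y a (u x)),
      nrm = (\<lambda>u. SUP x\<in>{x. x \<noteq> 0}. nrm Y (u x) / norm x)\<rparr>"

end

theory Submission
  imports Defs
begin

text \<open>
  The isometry is currying: \<open>f\<close> is sent to \<open>x \<mapsto> f(x, \<cdot>)\<close>. Expanding the multilinearity identity of \<open>f\<close>
  at tuples with zero entries kills all but the wanted summands, so \<open>f\<close> is multilinear in \<open>k + 1\<close>
  arguments iff it is linear in the first one and multilinear in the remaining \<open>k\<close>. Both norms are
  the least constant in the corresponding bound, hence they agree. A nonzero vector is needed so
  that the suprema are not taken over the empty set, where \<open>SUP\<close> is an unspecified real number.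
\<close>

subsection \<open>Suprema of quotients\<close>

text \<open>With the next lemma: the supremum of the quotients is the least constant
  \<open>K\<close> with \<open>g \<le> K * w\<close>. The assumed \<open>K\<close> bounds the
  quotients above, since \<open>SUP\<close> of an unbounded real family is unspecified.\<close>

lemma SUP_quotient_upper:
  fixes g w :: "'i \<Rightarrow> real"
  assumes "\<And>i. i \<in> I \<Longrightarrow> 0 < w i" and "\<And>i. i \<in> I \<Longrightarrow> g i \<le> K * w i" and "i \<in> I"
  shows "g i \<le> (SUP i\<in>I. g i / w i) * w i"
proof -
  have "bdd_above ((\<lambda>i. g i / w i) ` I)"
    using assms(1,2) by (auto intro!: bdd_aboveI[of _ K] simp: divide_le_eq)
  then have "g i / w i \<le> (SUP i\<in>I. g i / w i)"
    using assms(3) by (rule cSUP_upper2) simp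
  then show ?thesis using assms(1)[OF assms(3)] by (simp add: divide_le_eq)
qed

lemma SUP_quotient_least:
  fixes g w :: "'i \<Rightarrow> real"
  assumes "I \<noteq> {}" and "\<And>i. i \<in> I \<Longrightarrow> 0 < w i" and "\<And>i. i \<in> I \<Longrightarrow> g i \<le> K * w i"
  shows "(SUP i\<in>I. g i / w i) \<le> K"
  using assms by (intro cSUP_least) (auto simp: divide_le_eq)

text \<open>For \<open>a > 0\<close>, multiplying or dividing by \<open>a\<close> turns an
  admissible constant for one family into one for the other, so each least constant bounds the
  other. For \<open>a = 0\<close> the left side is the supremum of the constant \<open>0\<close>
  over a nonempty set.\<close>

lemma SUP_quotient_mult:
  fixes g w :: "'i \<Rightarrow> real"
  assumes I: "I \<noteq> {}" and w: "\<And>i. i \<in> I \<Longrightarrow> 0 < w i" and K: "\<And>i. i \<in> I \<Longrightarrow> g i \<le> K * w i"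
    and a: "0 \<le> a"
  shows "(SUP i\<in>I. a * g i / w i) = a * (SUP i\<in>I. g i / w i)"
proof (cases "a = 0")
  case True
  then show ?thesis using I by simp
next
  case False
  with a have a: "a > 0" by simp
  have ub: "g i \<le> (SUP i\<in>I. g i / w i) * w i" if "i \<in> I" for i
    using w K that by (rule SUP_quotient_upper)
  have aK: "a * g i \<le> (a * K) * w i" if "i \<in> I" for i
    using K[OF that] a by (simp add: mult.assoc)
  have ub': "a * g i \<le> (SUP i\<in>I. a * g i / w i) * w i" if "i \<in> I" for i
    using w aK that by (rule SUP_quotient_upper)
  have "(SUP i\<in>I. a * g i / w i) \<le> a * (SUP i\<in>I. g i / w i)"
    using I w ub a by (intro SUP_quotient_least) (auto simp: mult.assoc)
  moreover have "(SUP i\<in>I. g i / w i) \<le> (SUP i\<in>I. a * g i / w i) / a"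
    using I w ub' a by (intro SUP_quotient_least) (auto simp: field_simps)
  ultimately show ?thesis using a by (simp add: field_simps)
qed

subsection \<open>Isometric isomorphisms and spaces of operators\<close>

context real_normed_space
begin

text \<open>Definiteness of the norm gives this without cancellation: \<open>scale V 0 v\<close> has
  norm \<open>0 * nrm V v\<close>.\<close>

lemma scale_zero_left: "v \<in> carr V \<Longrightarrow> scale V 0 v = zero V"
  using nrm_eq_zero[OF scale_closed, of v 0] nrm_scale[of v 0] by simp

lemma scale_zero_right: "scale V a (zero V) = zero V"
  using scale_zero_left[OF zero_closed] scale_scale[OF zero_closed, of a 0] by simp

lemma nrm_zero: "nrm V (zero V) = 0"
  using nrm_eq_zero zero_closed by blast

lemma add_uminus: "v \<in> carr V \<Longrightarrow> add V v (scale V (-1) v) = zero V"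
  using scale_add_left[of v 1 "-1"] by (simp add: scale_one scale_zero_left)

lemma add_left_commute:
  "\<lbrakk>u \<in> carr V; v \<in> carr V; w \<in> carr V\<rbrakk> \<Longrightarrow> add V u (add V v w) = add V v (add V u w)"
  by (metis add_assoc add_commute)

end

lemma isometric_isomorphism_comp:
  assumes "isometric_isomorphism U V S" "isometric_isomorphism V W T"
  shows "isometric_isomorphism U W (T \<circ> S)"
proof -
  \<comment> \<open>The laws for \<open>T\<close> are only available on
    \<open>carr V\<close>.\<close>
  have "S u \<in> carr V" if "u \<in> carr U" for u
    using assms(1) that unfolding isometric_isomorphism_def bij_betw_def by blast
  then show ?thesis
    using assms unfolding isometric_isomorphism_def by (auto intro: bij_betw_trans)
qed

lemma carr_bounded_operators:
  "u \<in> carr (bounded_operators Y) \<longleftrightarrow>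
     (\<forall>x. u x \<in> carr Y) \<and> (\<forall>x y. u (x + y) = add Y (u x) (u y)) \<and>
     (\<forall>a x. u (a *\<^sub>R x) = scale Y a (u x)) \<and> (\<exists>K. \<forall>x. nrm Y (u x) \<le> K * norm x)"
  by (simp add: bounded_operators_def)

lemma bounded_operators_simps:
  "add (bounded_operators Y) = (\<lambda>u v x. add Y (u x) (v x))"
  "zero (bounded_operators Y) = (\<lambda>x. zero Y)"
  "scale (bounded_operators Y) = (\<lambda>a u x. scale Y a (u x))"
  "nrm (bounded_operators Y) u = (SUP x\<in>{x. x \<noteq> 0}. nrm Y (u x) / norm x)"
  by (simp_all add: bounded_operators_def)

text \<open>Serves to exchange the codomain \<open>dual_space 0\<close> for
  \<open>real_line\<close>. Composition with the inverse of \<open>J\<close> is the inverse map; it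
  stays among bounded operators because the inverse is again linear and norm preserving.\<close>

lemma isometric_isomorphism_bounded_operators:
  fixes V :: "'v nspace" and W :: "'w nspace"
  assumes V: "real_normed_space V" and J: "isometric_isomorphism V W J"
  shows "isometric_isomorphism (bounded_operators V :: ('a::real_normed_vector \<Rightarrow> 'v) nspace)
    (bounded_operators W) (\<lambda>u x. J (u x))"
proof -
  interpret V: real_normed_space V by (rule V)
  define I where "I = inv_into (carr V) J"
  have bij: "bij_betw J (carr V) (carr W)"
    and J_add: "\<And>u v. \<lbrakk>u \<in> carr V; v \<in> carr V\<rbrakk> \<Longrightarrow> J (add V u v) = add W (J u) (J v)"
    and J_scale: "\<And>a v. v \<in> carr V \<Longrightarrow> J (scale V a v) = scale W a (J v)"
    and J_nrm: "\<And>v. v \<in> carr V \<Longrightarrow> nrm W (J v) = nrm V v"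
    using J unfolding isometric_isomorphism_def by auto
  have JW: "J v \<in> carr W" if "v \<in> carr V" for v
    using bij that by (auto simp: bij_betw_def)
  have IV: "I w \<in> carr V" and JI: "J (I w) = w" if "w \<in> carr W" for w
    using bij that unfolding I_def by (auto simp: bij_betw_def inv_into_into f_inv_into_f)
  have IJ: "I (J v) = v" if "v \<in> carr V" for v
    using bij that unfolding I_def by (simp add: bij_betw_def)
  \<comment> \<open>Cancel \<open>J\<close> by \<open>IJ\<close> at the sum of the two preimages,
    which lies in \<open>carr V\<close> by closedness.\<close>
  have I_add: "I (add W u v) = add V (I u) (I v)" if "u \<in> carr W" "v \<in> carr W" for u v
    using IJ[OF V.add_closed[OF IV[OF that(1)] IV[OF that(2)]]] that by (simp add: J_add IV JI)
  have I_scale: "I (scale W a v) = scale V a (I v)" if "v \<in> carr W" for a v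
    using IJ[OF V.scale_closed[OF IV[OF that]]] that by (simp add: J_scale IV JI)
  have I_nrm: "nrm V (I w) = nrm W w" if "w \<in> carr W" for w
    using J_nrm[OF IV[OF that]] that by (simp add: JI)
  have "bij_betw (\<lambda>(u :: 'a \<Rightarrow> 'v) x. J (u x)) (carr (bounded_operators V)) (carr (bounded_operators W))"
    by (rule bij_betw_byWitness[where f' = "\<lambda>u x. I (u x)"])
      (auto simp: carr_bounded_operators JW IV JI IJ J_add J_scale J_nrm I_add I_scale I_nrm)
  then show ?thesis
    unfolding isometric_isomorphism_def
    by (auto simp: carr_bounded_operators bounded_operators_simps J_add J_scale J_nrm)
qed

context
  fixes Y :: "'v nspace" and e :: "'a::real_normed_vector"
  assumes Y: "real_normed_space Y" and e: "e \<noteq> 0"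
begin

interpretation real_normed_space Y by (rule Y)

lemma bounded_operator_zero:
  assumes "u \<in> carr (bounded_operators Y)"
  shows "u (0 :: 'a) = zero Y"
proof -
  have "u (0 *\<^sub>R 0) = scale Y 0 (u 0)" and "u 0 \<in> carr Y"
    using assms unfolding carr_bounded_operators by blast+
  then show ?thesis by (simp add: scale_zero_left)
qed

text \<open>The operator norm is itself an admissible constant. The point \<open>x = 0\<close> lies
  outside the supremum, but there both sides vanish.\<close>

lemma nrm_bounded_operators_upper:
  assumes u: "u \<in> carr (bounded_operators Y)"
  shows "nrm Y (u (x :: 'a)) \<le> nrm (bounded_operators Y) u * norm x"
proof (cases "x = 0")
  case True
  then show ?thesis using bounded_operator_zero[OF u] nrm_zero by simp
next
  case False
  obtain K where "\<And>x. nrm Y (u x) \<le> K * norm x"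
    using u unfolding carr_bounded_operators by blast
  then show ?thesis
    unfolding bounded_operators_simps using False
    by (intro SUP_quotient_upper[where K = K]) auto
qed

lemma nrm_bounded_operators_least:
  assumes "\<And>x :: 'a. nrm Y (u x) \<le> K * norm x"
  shows "nrm (bounded_operators Y) u \<le> K"
  unfolding bounded_operators_simps using assms e
  by (intro SUP_quotient_least) auto

text \<open>The vector \<open>e\<close> is a point where the factor \<open>norm x\<close> can be
  divided out.\<close>

lemma nrm_bounded_operators_nonneg:
  assumes u: "u \<in> carr (bounded_operators Y)"
  shows "0 \<le> nrm (bounded_operators Y) (u :: 'a \<Rightarrow> 'v)"
proof -
  have "0 \<le> nrm Y (u e)"
    using u by (simp add: carr_bounded_operators nrm_nonneg)
  also have "\<dots> \<le> nrm (bounded_operators Y) u * norm e"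
    using u by (rule nrm_bounded_operators_upper)
  finally show ?thesis using e by (simp add: zero_le_mult_iff)
qed

lemma real_normed_space_bounded_operators:
  "real_normed_space (bounded_operators Y :: ('a \<Rightarrow> 'v) nspace)" (is "real_normed_space ?B")
proof
  fix u v w :: "'a \<Rightarrow> 'v" and a b :: real
  show "zero ?B \<in> carr ?B"
    by (auto simp: carr_bounded_operators bounded_operators_simps zero_closed add_zero
        scale_zero_right nrm_zero intro: exI[of _ 0])
  show "add ?B u v \<in> carr ?B" if uv: "u \<in> carr ?B" "v \<in> carr ?B"
  proof -
    have "nrm Y (add Y (u x) (v x)) \<le> (nrm ?B u + nrm ?B v) * norm x" for x
    proof -
      have "nrm Y (add Y (u x) (v x)) \<le> nrm Y (u x) + nrm Y (v x)"
        using uv by (simp add: carr_bounded_operators nrm_triangle)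
      also have "\<dots> \<le> (nrm ?B u + nrm ?B v) * norm x"
        using uv[THEN nrm_bounded_operators_upper, of x] by (simp add: distrib_right)
      finally show ?thesis .
    qed
    then have "\<exists>K. \<forall>x. nrm Y (add Y (u x) (v x)) \<le> K * norm x" by blast
    \<comment> \<open>Additivity of the pointwise sum regroups four summands by
      \<open>add_left_commute\<close>.\<close>
    then show ?thesis using uv
      by (simp add: carr_bounded_operators bounded_operators_simps(1) add_closed scale_add_right
          add_assoc add_left_commute)
  qed
  show scl: "scale ?B a v \<in> carr ?B" if v: "v \<in> carr ?B" for a v
  proof -
    have "nrm Y (scale Y a (v x)) \<le> (\<bar>a\<bar> * nrm ?B v) * norm x" for x
      using v nrm_bounded_operators_upper[OF v, of x]
      by (simp add: carr_bounded_operators nrm_scale mult.assoc mult_left_mono)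
    then have "\<exists>K. \<forall>x. nrm Y (scale Y a (v x)) \<le> K * norm x" by blast
    then show ?thesis using v
      by (simp add: carr_bounded_operators bounded_operators_simps(3) scale_closed scale_add_right
          scale_scale mult.commute[of a])
  qed
  show "add ?B (add ?B u v) w = add ?B u (add ?B v w)"
    if "u \<in> carr ?B" "v \<in> carr ?B" "w \<in> carr ?B"
    using that by (simp add: carr_bounded_operators bounded_operators_simps(1) add_assoc)
  show "add ?B u v = add ?B v u" if "u \<in> carr ?B" "v \<in> carr ?B"
    using that by (auto simp: carr_bounded_operators bounded_operators_simps(1) add_commute)
  show "add ?B v (zero ?B) = v" if "v \<in> carr ?B"
    using that by (simp add: carr_bounded_operators bounded_operators_simps(1,2) add_zero)
  show "\<exists>w\<in>carr ?B. add ?B v w = zero ?B" if v: "v \<in> carr ?B"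
  \<comment> \<open>Inverses chosen pointwise need not visibly form a bounded operator; the multiple
    by \<open>-1\<close> does so by \<open>scl\<close>.\<close>
  proof (rule bexI)
    show "add ?B v (scale ?B (-1) v) = zero ?B"
      using v by (simp add: carr_bounded_operators bounded_operators_simps add_uminus)
  qed (rule scl[OF v])
  show "scale ?B a (add ?B u v) = add ?B (scale ?B a u) (scale ?B a v)"
    if "u \<in> carr ?B" "v \<in> carr ?B"
    using that by (simp add: carr_bounded_operators bounded_operators_simps(1,3) scale_add_right)
  show "scale ?B (a + b) v = add ?B (scale ?B a v) (scale ?B b v)" if "v \<in> carr ?B"
    using that by (simp add: carr_bounded_operators bounded_operators_simps(1,3) scale_add_left)
  show "scale ?B a (scale ?B b v) = scale ?B (a * b) v" if "v \<in> carr ?B"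
    using that by (simp add: carr_bounded_operators bounded_operators_simps(3) scale_scale)
  show "scale ?B 1 v = v" if "v \<in> carr ?B"
    using that by (simp add: carr_bounded_operators bounded_operators_simps(3) scale_one)
  show "0 \<le> nrm ?B v" if "v \<in> carr ?B"
    using that by (rule nrm_bounded_operators_nonneg)
  show "nrm ?B v = 0 \<longleftrightarrow> v = zero ?B" if v: "v \<in> carr ?B"
  proof
    assume "nrm ?B v = 0"
    then have "nrm Y (v x) \<le> 0" for x
      using nrm_bounded_operators_upper[OF v, of x] by simp
    then have "v x = zero Y" for x
      using v nrm_nonneg nrm_eq_zero unfolding carr_bounded_operators by (metis antisym)
    then show "v = zero ?B" by (simp add: bounded_operators_simps(2) fun_eq_iff)
  next
    assume z: "v = zero ?B"
    have "nrm ?B v \<le> 0"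
      by (rule nrm_bounded_operators_least) (simp add: z bounded_operators_simps(2) nrm_zero)
    then show "nrm ?B v = 0" using nrm_bounded_operators_nonneg[OF v] by simp
  qed
  show "nrm ?B (scale ?B a v) = \<bar>a\<bar> * nrm ?B v" if v: "v \<in> carr ?B"
  proof -
    obtain K where K: "\<And>x. nrm Y (v x) \<le> K * norm x"
      using v unfolding carr_bounded_operators by blast
    have "nrm ?B (scale ?B a v) = (SUP x\<in>{x. x \<noteq> 0}. \<bar>a\<bar> * nrm Y (v x) / norm x)"
      using v by (simp add: carr_bounded_operators bounded_operators_simps nrm_scale)
    also have "\<dots> = \<bar>a\<bar> * nrm ?B v"
      unfolding bounded_operators_simps using e K by (intro SUP_quotient_mult) auto
    finally show ?thesis .
  qed
  show "nrm ?B (add ?B u v) \<le> nrm ?B u + nrm ?B v" if uv: "u \<in> carr ?B" "v \<in> carr ?B"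
  proof (rule nrm_bounded_operators_least)
    fix x
    have "nrm Y (add ?B u v x) \<le> nrm Y (u x) + nrm Y (v x)"
      using uv by (simp add: carr_bounded_operators bounded_operators_simps(1) nrm_triangle)
    also have "\<dots> \<le> (nrm ?B u + nrm ?B v) * norm x"
      using uv[THEN nrm_bounded_operators_upper, of x] by (simp add: distrib_right)
    finally show "nrm Y (add ?B u v x) \<le> (nrm ?B u + nrm ?B v) * norm x" .
  qed
qed

end

subsection \<open>Multilinear functionals\<close>

lemma tuples_0: "tuples 0 = {[]}"
  by (auto simp: tuples_def)

lemma Cons_in_tuples: "x # xs \<in> tuples (Suc k) \<longleftrightarrow> xs \<in> tuples k"
  by (simp add: tuples_def)

lemma tuples_SucE:
  assumes "xs \<in> tuples (Suc k)"
  obtains y ys where "xs = y # ys" "ys \<in> tuples k"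
  using assms by (auto simp: tuples_def length_Suc_conv)

lemma tuples_closed:
  "\<lbrakk>xs \<in> tuples k; ys \<in> tuples k\<rbrakk> \<Longrightarrow> map2 h xs ys \<in> tuples k"
  "map g [0..<k] \<in> tuples k"
  by (auto simp: tuples_def)

lemma multilinear_0: "multilinear 0 f"
  by (simp add: multilinear_def tuples_0)

text \<open>Both identities evaluate \<open>f\<close> only at members of \<open>tuples k\<close>;
  this allows \<open>restrict\<close> to be dropped in multilinearity proofs.\<close>

lemma multilinear_cong:
  assumes "\<And>xs. xs \<in> tuples k \<Longrightarrow> f xs = g xs"
  shows "multilinear k f \<longleftrightarrow> multilinear k g"
  unfolding multilinear_def by (simp add: assms tuples_closed)

lemma multilinear_add:
  "\<lbrakk>multilinear k f; multilinear k g\<rbrakk> \<Longrightarrow> multilinear k (\<lambda>xs. f xs + g xs)"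
  unfolding multilinear_def by (simp add: sum.distrib distrib_left)

lemma multilinear_scale:
  "multilinear k f \<Longrightarrow> multilinear k (\<lambda>xs. a * f xs)"
  unfolding multilinear_def by (simp add: sum_distrib_left mult.left_commute)

text \<open>Scale the zero entries by \<open>0\<close> and the others by \<open>1\<close>: the tuple
  does not change, while the factor pulled out is \<open>0\<close>.\<close>

lemma multilinear_eq_0:
  assumes f: "multilinear k f" and xs: "xs \<in> tuples k" "0 \<in> set xs"
  shows "f xs = 0"
proof -
  define as :: "real list" where "as = map (\<lambda>x. if x = 0 then 0 else 1) xs"
  have "map2 (*\<^sub>R) as xs = xs" unfolding as_def by (induction xs) auto
  moreover have "prod_list as = 0"
    using xs(2) by (auto simp: as_def prod_list_zero_iff)
  moreover have "as \<in> tuples k" using xs(1) by (simp add: as_def tuples_def)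
  ultimately show ?thesis using f xs(1) unfolding multilinear_def by (metis mult_zero_left)
qed

text \<open>Sort the index sets by whether they contain \<open>0\<close>, the position of the head,
  and shift the other positions down by one.\<close>

lemma sum_Pow_lessThan_Suc:
  fixes g :: "nat set \<Rightarrow> 'b::comm_monoid_add"
  shows "(\<Sum>S\<in>Pow {..<Suc k}. g S) = (\<Sum>S\<in>Pow {..<k}. g (insert 0 (Suc ` S)) + g (Suc ` S))"
proof -
  have P: "Pow {..<Suc k} = (\<lambda>S. insert 0 (Suc ` S)) ` Pow {..<k} \<union> (`) Suc ` Pow {..<k}"
    unfolding lessThan_Suc_eq_insert_0 Pow_insert image_Pow_surj[OF refl, symmetric]
    by (auto simp: image_image)
  have disj: "(\<lambda>S. insert 0 (Suc ` S)) ` Pow {..<k} \<inter> (`) Suc ` Pow {..<k} = {}"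
    by auto
  have inj: "inj_on (\<lambda>S. insert 0 (Suc ` S)) (Pow {..<k})" "inj_on ((`) Suc) (Pow {..<k})"
    by (auto intro!: inj_onI)
  show ?thesis
    unfolding P by (subst sum.union_disjoint) (use disj inj in \<open>auto simp: sum.reindex sum.distrib\<close>)
qed

text \<open>Index sets containing \<open>0\<close> select the head \<open>x\<close>, the others
  select \<open>y\<close>; the shifted set governs the tail.\<close>

lemma multilinear_sum_Cons:
  "(\<Sum>S\<in>Pow {..<Suc k}. f (map (\<lambda>i. if i \<in> S then (x # xs) ! i else (y # ys) ! i) [0..<Suc k])) =
   (\<Sum>S\<in>Pow {..<k}. f (x # map (\<lambda>i. if i \<in> S then xs ! i else ys ! i) [0..<k])
      + (f (y # map (\<lambda>i. if i \<in> S then xs ! i else ys ! i) [0..<k]) :: real))"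
proof -
  have "map (\<lambda>i. if i \<in> insert 0 (Suc ` S) then (x # xs) ! i else (y # ys) ! i) [0..<Suc k] =
        x # map (\<lambda>i. if i \<in> S then xs ! i else ys ! i) [0..<k]"
    "map (\<lambda>i. if i \<in> Suc ` S then (x # xs) ! i else (y # ys) ! i) [0..<Suc k] =
        y # map (\<lambda>i. if i \<in> S then xs ! i else ys ! i) [0..<k]" for S
    by (simp_all only: map_upt_Suc) (auto simp: image_iff)
  then show ?thesis unfolding sum_Pow_lessThan_Suc by simp
qed

text \<open>Specialised twice below: \<open>y = 0\<close> isolates the tail, and
  \<open>ys = replicate k 0\<close> isolates the head.\<close>

lemma multilinear_Suc_add:
  assumes f: "multilinear (Suc k) f" and "xs \<in> tuples k" "ys \<in> tuples k"
  shows "f ((x + y) # map2 (+) xs ys) =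
    (\<Sum>S\<in>Pow {..<k}. f (x # map (\<lambda>i. if i \<in> S then xs ! i else ys ! i) [0..<k])
      + f (y # map (\<lambda>i. if i \<in> S then xs ! i else ys ! i) [0..<k]))"
proof -
  have "x # xs \<in> tuples (Suc k)" "y # ys \<in> tuples (Suc k)"
    using assms by (simp_all add: Cons_in_tuples)
  then have "f (map2 (+) (x # xs) (y # ys)) =
    (\<Sum>S\<in>Pow {..<Suc k}. f (map (\<lambda>i. if i \<in> S then (x # xs) ! i else (y # ys) ! i) [0..<Suc k]))"
    using f unfolding multilinear_def by blast
  then show ?thesis unfolding multilinear_sum_Cons by simp
qed

lemma multilinear_Suc_scale:
  assumes "multilinear (Suc k) f" and "xs \<in> tuples k" "as \<in> tuples k"
  shows "f ((a *\<^sub>R x) # map2 (*\<^sub>R) as xs) = a * prod_list as * f (x # xs)"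
proof -
  have "x # xs \<in> tuples (Suc k)" "a # as \<in> tuples (Suc k)"
    using assms by (simp_all add: Cons_in_tuples)
  then have "f (map2 (*\<^sub>R) (a # as) (x # xs)) = prod_list (a # as) * f (x # xs)"
    using assms(1) unfolding multilinear_def by blast
  then show ?thesis by simp
qed

text \<open>Read forwards it makes curried functionals linear operators; read backwards it makes
  uncurried operators multilinear.\<close>

lemma multilinear_Suc_iff:
  "multilinear (Suc k) f \<longleftrightarrow>
     (\<forall>x. multilinear k (\<lambda>xs. f (x # xs))) \<and>
     (\<forall>x y. \<forall>xs\<in>tuples k. f ((x + y) # xs) = f (x # xs) + f (y # xs)) \<and>
     (\<forall>a x. \<forall>xs\<in>tuples k. f ((a *\<^sub>R x) # xs) = a * f (x # xs))"
  (is "_ \<longleftrightarrow> ?tail \<and> ?head_add \<and> ?head_scale")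
proof
  assume f: "multilinear (Suc k) f"
  have z: "f zs = 0" if "zs \<in> tuples (Suc k)" "0 \<in> set zs" for zs
    using f that by (rule multilinear_eq_0)
  have "multilinear k (\<lambda>xs. f (x # xs))" for x
    unfolding multilinear_def
  proof (intro conjI ballI)
    fix xs ys :: "'a list" assume "xs \<in> tuples k" "ys \<in> tuples k"
    \<comment> \<open>The summands with head \<open>0\<close> vanish by \<open>z\<close>.\<close>
    from multilinear_Suc_add[OF f this, of x 0]
    show "f (x # map2 (+) xs ys) =
      (\<Sum>S\<in>Pow {..<k}. f (x # map (\<lambda>i. if i \<in> S then xs ! i else ys ! i) [0..<k]))"
      by (simp add: z Cons_in_tuples tuples_closed)
  next
    fix as :: "real list" and xs :: "'a list" assume "as \<in> tuples k" "xs \<in> tuples k"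
    from multilinear_Suc_scale[OF f this(2,1), of 1 x]
    show "f (x # map2 (*\<^sub>R) as xs) = prod_list as * f (x # xs)" by simp
  qed
  moreover have "f ((x + y) # xs) = f (x # xs) + f (y # xs)" if xs: "xs \<in> tuples k" for x y xs
  proof -
    define m where "m S = map (\<lambda>i. if i \<in> S then xs ! i else replicate k 0 ! i) [0..<k]" for S
    have "replicate k 0 \<in> tuples k" by (simp add: tuples_def)
    from multilinear_Suc_add[OF f xs this, of x y]
    have "f ((x + y) # map2 (+) xs (replicate k 0)) = (\<Sum>S\<in>Pow {..<k}. f (x # m S) + f (y # m S))"
      by (simp only: m_def)
    moreover have "map2 (+) xs (replicate k 0) = xs"
      using xs by (intro nth_equalityI) (auto simp: tuples_def)
    \<comment> \<open>Unless \<open>S\<close> is the full index set, \<open>m S\<close> takes some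
      entry from the zero tuple, so only one index set contributes.\<close>
    moreover have "f (u # m S) = 0" if "S \<in> Pow {..<k} - {{..<k}}" for u S
    proof (rule z)
      show "u # m S \<in> tuples (Suc k)" by (simp add: m_def Cons_in_tuples tuples_closed)
      from that obtain i where "i < k" "i \<notin> S" by blast
      then show "0 \<in> set (u # m S)" by (auto simp: m_def image_iff intro!: bexI[of _ i])
    qed
    then have "(\<Sum>S\<in>Pow {..<k}. f (x # m S) + f (y # m S))
        = (\<Sum>S\<in>{{..<k}}. f (x # m S) + f (y # m S))"
      by (intro sum.mono_neutral_right) auto
    moreover have "m {..<k} = xs"
      using xs by (intro nth_equalityI) (auto simp: tuples_def m_def)
    ultimately show ?thesis by simp
  qed
  moreover have "f ((a *\<^sub>R x) # xs) = a * f (x # xs)" if xs: "xs \<in> tuples k" for a x xs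
  proof -
    \<comment> \<open>Scaling the tail by ones leaves it fixed and isolates the head factor
      \<open>a\<close>.\<close>
    have "replicate k 1 \<in> tuples k" by (simp add: tuples_def)
    from multilinear_Suc_scale[OF f xs this, of a x]
    have "f ((a *\<^sub>R x) # map2 (*\<^sub>R) (replicate k 1) xs) = a * f (x # xs)" by simp
    moreover have "map2 (*\<^sub>R) (replicate k 1) xs = xs"
      using xs by (intro nth_equalityI) (auto simp: tuples_def)
    ultimately show ?thesis by simp
  qed
  ultimately show "?tail \<and> ?head_add \<and> ?head_scale" by blast
next
  assume R: "?tail \<and> ?head_add \<and> ?head_scale"
  show "multilinear (Suc k) f"
    unfolding multilinear_def
  proof (intro conjI ballI)
    fix xs ys :: "'a list" assume "xs \<in> tuples (Suc k)" "ys \<in> tuples (Suc k)"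
    then obtain x xs' y ys' where [simp]: "xs = x # xs'" "ys = y # ys'"
      and t: "xs' \<in> tuples k" "ys' \<in> tuples k"
      by (metis tuples_SucE)
    have tail: "f (u # map2 (+) xs' ys') =
      (\<Sum>S\<in>Pow {..<k}. f (u # map (\<lambda>i. if i \<in> S then xs' ! i else ys' ! i) [0..<k]))" for u
      using R t unfolding multilinear_def by blast
    \<comment> \<open>First split the head by additivity; then \<open>tail\<close> expands each of
      the two values.\<close>
    have "f (map2 (+) xs ys) = f (x # map2 (+) xs' ys') + f (y # map2 (+) xs' ys')"
      using R t by (simp add: tuples_closed)
    then show "f (map2 (+) xs ys) =
      (\<Sum>S\<in>Pow {..<Suc k}. f (map (\<lambda>i. if i \<in> S then xs ! i else ys ! i) [0..<Suc k]))"
      unfolding \<open>xs = _\<close> \<open>ys = _\<close> multilinear_sum_Cons by (simp add: tail sum.distrib)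
  next
    fix as :: "real list" and xs :: "'a list"
    assume "as \<in> tuples (Suc k)" "xs \<in> tuples (Suc k)"
    then obtain x xs' a as' where [simp]: "xs = x # xs'" "as = a # as'"
      and t: "xs' \<in> tuples k" "as' \<in> tuples k"
      by (metis tuples_SucE)
    have "f (x # map2 (*\<^sub>R) as' xs') = prod_list as' * f (x # xs')"
      using R t unfolding multilinear_def by blast
    then show "f (map2 (*\<^sub>R) as xs) = prod_list as * f xs"
      using R t by (simp add: tuples_closed)
  qed
qed

subsection \<open>The dual spaces\<close>

lemma prod_list_norm_nonneg: "0 \<le> prod_list (map norm xs)"
  by (induction xs) auto

lemma prod_list_norm_pos: "0 \<notin> set xs \<Longrightarrow> 0 < prod_list (map norm xs)"
  by (induction xs) auto

text \<open>The definition asks for a positive constant; \<open>max K 1\<close> lets any real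
  \<open>K\<close> serve, including \<open>0\<close> and norms that may vanish.\<close>

lemma bounded_functionalI:
  assumes "\<And>xs. xs \<in> tuples k \<Longrightarrow> \<bar>f xs\<bar> \<le> K * prod_list (map norm xs)"
  shows "bounded_functional k f"
proof -
  have "\<bar>f xs\<bar> \<le> max K 1 * prod_list (map norm xs)" if "xs \<in> tuples k" for xs
    using assms[OF that] mult_right_mono[OF max.cobounded1 prod_list_norm_nonneg]
    by (rule order_trans)
  then show ?thesis
    unfolding bounded_functional_def by (intro exI[of _ "max K 1"]) auto
qed

lemma carr_dual_space:
  "f \<in> carr (dual_space k) \<longleftrightarrow> f \<in> extensional (tuples k) \<and> multilinear k f \<and> bounded_functional k f"
  by (simp add: dual_space_def)

lemma dual_space_simps:
  "add (dual_space k) = (\<lambda>f g. \<lambda>xs\<in>tuples k. f xs + g xs)"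
  "zero (dual_space k) = (\<lambda>xs\<in>tuples k. 0)"
  "scale (dual_space k) = (\<lambda>a f. \<lambda>xs\<in>tuples k. a * f xs)"
  "nrm (dual_space k) f =
     (SUP xs\<in>{xs \<in> tuples k. 0 \<notin> set xs}. \<bar>f xs\<bar> / prod_list (map norm xs))"
  by (simp_all add: dual_space_def)

lemma dual_space_eqI:
  assumes "f \<in> carr (dual_space k)" "g \<in> carr (dual_space k)"
    and "\<And>xs. xs \<in> tuples k \<Longrightarrow> f xs = g xs"
  shows "f = g"
  using assms by (auto simp: carr_dual_space intro: extensionalityI)

text \<open>Tuples with a zero entry are left out of the supremum; on them both sides
  vanish.\<close>

lemma nrm_dual_space_upper:
  assumes f: "f \<in> carr (dual_space k)" and xs: "xs \<in> tuples k"
  shows "\<bar>f xs\<bar> \<le> nrm (dual_space k) f * prod_list (map norm xs)"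
proof (cases "0 \<in> set xs")
  case True
  then have "f xs = 0"
    using f xs by (auto simp: carr_dual_space intro: multilinear_eq_0)
  moreover have "prod_list (map norm xs) = 0"
    using True by (force simp: prod_list_zero_iff)
  ultimately show ?thesis by simp
next
  case False
  obtain K where "\<And>xs. xs \<in> tuples k \<Longrightarrow> \<bar>f xs\<bar> \<le> K * prod_list (map norm xs)"
    using f unfolding carr_dual_space bounded_functional_def by blast
  then show ?thesis
    unfolding dual_space_simps using False xs
    by (intro SUP_quotient_upper[where K = K]) (auto intro: prod_list_norm_pos)
qed

context
  fixes e :: "'a::real_normed_vector"
  assumes e: "e \<noteq> 0"
begin

lemma nonzero_tuples_nonempty: "{xs \<in> tuples k. (0 :: 'a) \<notin> set xs} \<noteq> {}"
proof -
  have "replicate k e \<in> {xs \<in> tuples k. 0 \<notin> set xs}"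
    using e by (auto simp: tuples_def)
  then show ?thesis by blast
qed

lemma nrm_dual_space_least:
  assumes "\<And>xs :: 'a list. xs \<in> tuples k \<Longrightarrow> \<bar>f xs\<bar> \<le> K * prod_list (map norm xs)"
  shows "nrm (dual_space k) f \<le> K"
  unfolding dual_space_simps using assms nonzero_tuples_nonempty
  by (intro SUP_quotient_least) (auto intro: prod_list_norm_pos)

lemma nrm_dual_space_nonneg:
  fixes f :: "'a list \<Rightarrow> real"
  assumes f: "f \<in> carr (dual_space k)"
  shows "0 \<le> nrm (dual_space k) f"
proof -
  obtain xs :: "'a list" where xs: "xs \<in> tuples k" "0 \<notin> set xs"
    using nonzero_tuples_nonempty by blast
  have "0 \<le> \<bar>f xs\<bar>" by simp
  also have "\<dots> \<le> nrm (dual_space k) f * prod_list (map norm xs)"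
    using f xs(1) by (rule nrm_dual_space_upper)
  finally show ?thesis using prod_list_norm_pos[OF xs(2)] by (simp add: zero_le_mult_iff)
qed

lemma real_normed_space_dual_space:
  "real_normed_space (dual_space k :: ('a list \<Rightarrow> real) nspace)" (is "real_normed_space ?D")
proof
  fix u v w :: "'a list \<Rightarrow> real" and a b :: real
  show "zero ?D \<in> carr ?D"
    unfolding carr_dual_space dual_space_simps(2)
    by (auto simp: multilinear_def tuples_closed intro!: bounded_functionalI[of _ _ 0])
  have add_bound: "\<bar>u xs + v xs\<bar> \<le> (nrm ?D u + nrm ?D v) * prod_list (map norm xs)"
    if "u \<in> carr ?D" "v \<in> carr ?D" "xs \<in> tuples k" for xs
    using that(1,2)[THEN nrm_dual_space_upper, OF that(3)] by (simp add: distrib_right)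
  show "add ?D u v \<in> carr ?D" if uv: "u \<in> carr ?D" "v \<in> carr ?D"
  proof -
    have "multilinear k (add ?D u v)"
      using uv multilinear_add unfolding carr_dual_space dual_space_simps(1)
      by (subst multilinear_cong[where g = "\<lambda>xs. u xs + v xs"]) auto
    moreover have "bounded_functional k (add ?D u v)"
      using add_bound[OF uv] by (intro bounded_functionalI) (simp add: dual_space_simps(1))
    ultimately show ?thesis by (simp add: carr_dual_space dual_space_simps(1))
  qed
  show scl: "scale ?D a v \<in> carr ?D" if v: "v \<in> carr ?D" for a v
  proof -
    have "multilinear k (scale ?D a v)"
      using v multilinear_scale unfolding carr_dual_space dual_space_simps(3)
      by (subst multilinear_cong[where g = "\<lambda>xs. a * v xs"]) auto
    moreover have "bounded_functional k (scale ?D a v)"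
      using nrm_dual_space_upper[OF v]
      by (intro bounded_functionalI[where K = "\<bar>a\<bar> * nrm ?D v"])
        (simp add: dual_space_simps(3) abs_mult mult.assoc mult_left_mono)
    ultimately show ?thesis by (simp add: carr_dual_space dual_space_simps(3))
  qed
  show "add ?D (add ?D u v) w = add ?D u (add ?D v w)"
    by (auto simp: dual_space_simps(1) restrict_def fun_eq_iff)
  show "add ?D u v = add ?D v u"
    by (auto simp: dual_space_simps(1) restrict_def fun_eq_iff)
  \<comment> \<open>Off \<open>tuples k\<close> the sum is \<open>undefined\<close>, and so is
    \<open>v\<close> by extensionality.\<close>
  show "add ?D v (zero ?D) = v" if "v \<in> carr ?D"
    using that by (auto simp: carr_dual_space dual_space_simps(1,2) restrict_def fun_eq_iff
        extensional_def)
  show "\<exists>w\<in>carr ?D. add ?D v w = zero ?D" if v: "v \<in> carr ?D"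
  proof (rule bexI)
    show "add ?D v (scale ?D (-1) v) = zero ?D"
      by (auto simp: dual_space_simps restrict_def fun_eq_iff)
  qed (rule scl[OF v])
  show "scale ?D a (add ?D u v) = add ?D (scale ?D a u) (scale ?D a v)"
    by (auto simp: dual_space_simps(1,3) restrict_def fun_eq_iff distrib_left)
  show "scale ?D (a + b) v = add ?D (scale ?D a v) (scale ?D b v)"
    by (auto simp: dual_space_simps(1,3) restrict_def fun_eq_iff distrib_right)
  show "scale ?D a (scale ?D b v) = scale ?D (a * b) v"
    by (auto simp: dual_space_simps(3) restrict_def fun_eq_iff)
  show "scale ?D 1 v = v" if "v \<in> carr ?D"
    using that by (auto simp: carr_dual_space dual_space_simps(3) restrict_def fun_eq_iff
        extensional_def)
  show "0 \<le> nrm ?D v" if "v \<in> carr ?D"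
    using that by (rule nrm_dual_space_nonneg)
  show "nrm ?D v = 0 \<longleftrightarrow> v = zero ?D" if v: "v \<in> carr ?D"
  proof
    assume "nrm ?D v = 0"
    then have "v xs = 0" if "xs \<in> tuples k" for xs
      using nrm_dual_space_upper[OF v that] by simp
    then show "v = zero ?D"
      using v by (auto simp: carr_dual_space dual_space_simps(2) restrict_def fun_eq_iff
          extensional_def)
  next
    assume z: "v = zero ?D"
    have "nrm ?D v \<le> 0"
      by (rule nrm_dual_space_least) (simp add: z dual_space_simps(2))
    then show "nrm ?D v = 0" using nrm_dual_space_nonneg[OF v] by simp
  qed
  show "nrm ?D (scale ?D a v) = \<bar>a\<bar> * nrm ?D v" if v: "v \<in> carr ?D"
  proof -
    have "nrm ?D (scale ?D a v) =
        (SUP xs\<in>{xs \<in> tuples k. 0 \<notin> set xs}. \<bar>a\<bar> * \<bar>v xs\<bar> / prod_list (map norm xs))"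
      by (simp add: dual_space_simps abs_mult)
    also have "\<dots> = \<bar>a\<bar> * nrm ?D v"
      unfolding dual_space_simps(4)
    proof (rule SUP_quotient_mult[where K = "nrm ?D v"])
      show "\<bar>v xs\<bar> \<le> nrm ?D v * prod_list (map norm xs)"
        if "xs \<in> {xs \<in> tuples k. 0 \<notin> set xs}" for xs
        using nrm_dual_space_upper[OF v] that by blast
    qed (use nonzero_tuples_nonempty in \<open>auto intro: prod_list_norm_pos\<close>)
    finally show ?thesis .
  qed
  show "nrm ?D (add ?D u v) \<le> nrm ?D u + nrm ?D v" if uv: "u \<in> carr ?D" "v \<in> carr ?D"
    using add_bound[OF uv] by (intro nrm_dual_space_least) (simp add: dual_space_simps(1))
qed

text \<open>Matches the formal case \<open>k = 0\<close> with the convention that the 0-dual is the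
  real line. The only 0-tuple is \<open>[]\<close>, so every extensional function qualifies, and the
  norm is the single quotient with empty product \<open>1\<close>.\<close>

lemma isometric_isomorphism_dual_space_0:
  "isometric_isomorphism (dual_space 0 :: ('a list \<Rightarrow> real) nspace) real_line (\<lambda>f. f [])"
proof -
  let ?D = "dual_space 0 :: ('a list \<Rightarrow> real) nspace"
  have carr: "f \<in> carr ?D \<longleftrightarrow> f \<in> extensional {[]}" for f
    by (auto simp: carr_dual_space multilinear_0 tuples_0 intro!: bounded_functionalI[of _ _ "\<bar>f []\<bar>"])
  have "bij_betw (\<lambda>f. f []) (carr ?D) UNIV"
    by (rule bij_betw_byWitness[where f' = "\<lambda>c. \<lambda>xs\<in>{[]}. c"])
      (auto simp: carr extensional_def fun_eq_iff restrict_def)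
  moreover have "{xs. xs = [] \<and> (0 :: 'a) \<notin> set xs} = {[]}" by auto
  ultimately show ?thesis
    unfolding isometric_isomorphism_def real_line_def
    by (auto simp: dual_space_simps tuples_0)
qed

subsection \<open>Currying\<close>

text \<open>With \<open>x\<close> fixed, \<open>norm x\<close> is absorbed into the constant. The
  norm estimate yields both boundedness of the curried operator and one half of the
  isometry.\<close>

lemma curry_in_dual_space:
  fixes f :: "'a list \<Rightarrow> real"
  assumes f: "f \<in> carr (dual_space (Suc k))"
  shows "(\<lambda>xs\<in>tuples k. f (x # xs)) \<in> carr (dual_space k)"
    and "nrm (dual_space k) (\<lambda>xs\<in>tuples k. f (x # xs)) \<le> nrm (dual_space (Suc k)) f * norm x"
proof -
  have bound: "\<bar>f (x # xs)\<bar> \<le> (nrm (dual_space (Suc k)) f * norm x) * prod_list (map norm xs)"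
    if "xs \<in> tuples k" for xs
    using nrm_dual_space_upper[OF f, of "x # xs"] that by (simp add: Cons_in_tuples mult.assoc)
  have "multilinear k (\<lambda>xs. f (x # xs))"
    using f unfolding carr_dual_space multilinear_Suc_iff by blast
  then have "multilinear k (\<lambda>xs\<in>tuples k. f (x # xs))"
    by (subst multilinear_cong[where g = "\<lambda>xs. f (x # xs)"]) auto
  moreover have "bounded_functional k (\<lambda>xs\<in>tuples k. f (x # xs))"
    using bound by (intro bounded_functionalI) simp
  ultimately show "(\<lambda>xs\<in>tuples k. f (x # xs)) \<in> carr (dual_space k)"
    by (simp add: carr_dual_space)
  show "nrm (dual_space k) (\<lambda>xs\<in>tuples k. f (x # xs)) \<le> nrm (dual_space (Suc k)) f * norm x"
    using bound by (intro nrm_dual_space_least) simp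
qed

lemma curry_in_bounded_operators:
  fixes f :: "'a list \<Rightarrow> real"
  assumes f: "f \<in> carr (dual_space (Suc k))"
  shows "(\<lambda>x. \<lambda>xs\<in>tuples k. f (x # xs)) \<in> carr (bounded_operators (dual_space k))"
proof -
  have "multilinear (Suc k) f" using f by (simp add: carr_dual_space)
  then have
    "(\<lambda>xs\<in>tuples k. f ((x + y) # xs)) =
       add (dual_space k) (\<lambda>xs\<in>tuples k. f (x # xs)) (\<lambda>xs\<in>tuples k. f (y # xs))"
    "(\<lambda>xs\<in>tuples k. f ((a *\<^sub>R x) # xs)) = scale (dual_space k) a (\<lambda>xs\<in>tuples k. f (x # xs))"
    for a x y
    by (auto simp: multilinear_Suc_iff dual_space_simps(1,3) restrict_def fun_eq_iff)
  then show ?thesis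
    using curry_in_dual_space[OF f] by (auto simp: carr_bounded_operators)
qed

text \<open>Bounding first the functional \<open>u y\<close>, then the operator \<open>u\<close>,
  shows that the operator norm of \<open>u\<close> is an admissible constant for the uncurried
  functional. This is the other half of the isometry.\<close>

lemma uncurry_in_dual_space:
  fixes u :: "'a \<Rightarrow> 'a list \<Rightarrow> real"
  assumes u: "u \<in> carr (bounded_operators (dual_space k))"
  shows "(\<lambda>xs\<in>tuples (Suc k). u (hd xs) (tl xs)) \<in> carr (dual_space (Suc k))"
    and "nrm (dual_space (Suc k)) (\<lambda>xs\<in>tuples (Suc k). u (hd xs) (tl xs))
           \<le> nrm (bounded_operators (dual_space k)) u"
proof -
  let ?f = "\<lambda>xs\<in>tuples (Suc k). u (hd xs) (tl xs)"
  let ?N = "nrm (bounded_operators (dual_space k)) u"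
  have ux: "u x \<in> carr (dual_space k)"
    and u_add: "u (x + y) = add (dual_space k) (u x) (u y)"
    and u_scale: "u (a *\<^sub>R x) = scale (dual_space k) a (u x)" for x y a
    using u by (auto simp: carr_bounded_operators)
  have "multilinear (Suc k) (\<lambda>xs. u (hd xs) (tl xs))"
    using ux by (simp add: multilinear_Suc_iff u_add u_scale dual_space_simps(1,3) carr_dual_space)
  then have "multilinear (Suc k) ?f"
    by (subst multilinear_cong[where g = "\<lambda>xs. u (hd xs) (tl xs)"]) auto
  moreover have bound: "\<bar>?f xs\<bar> \<le> ?N * prod_list (map norm xs)" if xs: "xs \<in> tuples (Suc k)" for xs
  proof -
    from xs obtain y ys where [simp]: "xs = y # ys" and ys: "ys \<in> tuples k"
      by (rule tuples_SucE)
    have "\<bar>?f xs\<bar> \<le> nrm (dual_space k) (u y) * prod_list (map norm ys)"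
      using nrm_dual_space_upper[OF ux ys] xs by simp
    also have "\<dots> \<le> (?N * norm y) * prod_list (map norm ys)"
      by (intro mult_right_mono prod_list_norm_nonneg
          nrm_bounded_operators_upper[OF real_normed_space_dual_space e u])
    finally show ?thesis by (simp add: mult.assoc)
  qed
  then have "bounded_functional (Suc k) ?f" by (rule bounded_functionalI)
  ultimately show "?f \<in> carr (dual_space (Suc k))" by (simp add: carr_dual_space)
  show "nrm (dual_space (Suc k)) ?f \<le> ?N"
    using bound by (rule nrm_dual_space_least)
qed

lemma isometric_isomorphism_curry:
  "isometric_isomorphism (dual_space (Suc k) :: ('a list \<Rightarrow> real) nspace)
     (bounded_operators (dual_space k)) (\<lambda>f x. \<lambda>xs\<in>tuples k. f (x # xs))"
proof -
  let ?D = "dual_space (Suc k) :: ('a list \<Rightarrow> real) nspace"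
  let ?B = "bounded_operators (dual_space k) :: ('a \<Rightarrow> 'a list \<Rightarrow> real) nspace"
  let ?C = "\<lambda>f (x :: 'a). \<lambda>xs\<in>tuples k. f (x # xs) :: real"
  let ?U = "\<lambda>u. \<lambda>xs\<in>tuples (Suc k). u (hd xs) (tl xs) :: real"
  have UC: "?U (?C f) = f" if f: "f \<in> carr ?D" for f
  proof (rule dual_space_eqI[OF uncurry_in_dual_space(1)[OF curry_in_bounded_operators[OF f]] f])
    show "?U (?C f) xs = f xs" if "xs \<in> tuples (Suc k)" for xs
      using that by (auto elim!: tuples_SucE simp: Cons_in_tuples)
  qed
  have CU: "?C (?U u) = u" if u: "u \<in> carr ?B" for u
  proof
    fix x
    \<comment> \<open>Extensionality of \<open>u x\<close> settles the lists outside
      \<open>tuples k\<close>, where the curried side is \<open>undefined\<close>.\<close>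
    have "u x \<in> carr (dual_space k)" using u by (simp add: carr_bounded_operators)
    then show "?C (?U u) x = u x"
      by (auto simp: carr_dual_space Cons_in_tuples extensional_def fun_eq_iff restrict_def)
  qed
  have bij: "bij_betw ?C (carr ?D) (carr ?B)"
  proof (rule bij_betw_byWitness[where f' = ?U])
    show "\<forall>f\<in>carr ?D. ?U (?C f) = f" using UC by blast
    show "\<forall>u\<in>carr ?B. ?C (?U u) = u" using CU by blast
    show "?C ` carr ?D \<subseteq> carr ?B" using curry_in_bounded_operators by blast
    show "?U ` carr ?B \<subseteq> carr ?D" using uncurry_in_dual_space(1) by blast
  qed
  have "nrm ?B (?C f) = nrm ?D f" if f: "f \<in> carr ?D" for f
  proof (rule antisym)
    show "nrm ?B (?C f) \<le> nrm ?D f"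
      by (rule nrm_bounded_operators_least[OF real_normed_space_dual_space e
            curry_in_dual_space(2)[OF f]])
    \<comment> \<open>Apply the uncurrying estimate to \<open>?C f\<close>, whose uncurried form is
      \<open>f\<close>.\<close>
    show "nrm ?D f \<le> nrm ?B (?C f)"
      using uncurry_in_dual_space(2)[OF curry_in_bounded_operators[OF f]] by (simp only: UC[OF f])
  qed
  moreover have "?C (add ?D f g) = add ?B (?C f) (?C g)" "?C (scale ?D a f) = scale ?B a (?C f)"
    for f g a
    by (auto simp: bounded_operators_simps(1,3) dual_space_simps(1,3) Cons_in_tuples
        restrict_def fun_eq_iff)
  ultimately show ?thesis
    using bij unfolding isometric_isomorphism_def by blast
qed

end

section \<open>The real line as codomain, and the identification for every \<open>n\<close>\<close>

lemma real_normed_space_real_line: "real_normed_space real_line"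
  by standard (auto simp: real_line_def algebra_simps abs_mult intro: exI[of _ "- v" for v])

text \<open>The dimension is expressed by a Hamel basis \<open>B\<close>, possibly infinite. The
  cases are separate because \<open>real_line\<close> and \<open>dual_space (n - 1)\<close> live on
  different types.\<close>

theorem theorem3p2:
  fixes n :: nat and B :: "'a::real_normed_vector set"
  assumes "n \<ge> 1"
    and "independent B" and "span B = UNIV" and "infinite B \<or> card B \<ge> n"
  shows "(n = 1 \<longrightarrow>
            (dual_space 1 :: ('a list \<Rightarrow> real) nspace)
              \<cong>\<^sub>n (bounded_operators real_line :: ('a \<Rightarrow> real) nspace)) \<and>
         (n \<ge> 2 \<longrightarrow>
            (dual_space n :: ('a list \<Rightarrow> real) nspace)
              \<cong>\<^sub>n (bounded_operators (dual_space (n - 1)) :: ('a \<Rightarrow> 'a list \<Rightarrow> real) nspace))"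
proof -
  \<comment> \<open>Dimension at least \<open>1\<close> provides a basis vector, which is nonzero by
    independence.\<close>
  have "B \<noteq> {}" using assms(1,4) by auto
  then obtain e where "e \<in> B" by blast
  with assms(2) have e: "e \<noteq> 0" using dependent_zero by blast
  note dual = real_normed_space_dual_space[OF e]
  \<comment> \<open>For \<open>n = 1\<close>, currying lands in operators into
    \<open>dual_space 0\<close>; evaluation at \<open>[]\<close> then moves the values to
    \<open>real_line\<close>.\<close>
  have "isometric_isomorphism (dual_space 1 :: ('a list \<Rightarrow> real) nspace) (bounded_operators real_line)
      ((\<lambda>u x. u x []) \<circ> (\<lambda>f x. \<lambda>xs\<in>tuples 0. f (x # xs)))"
    unfolding One_nat_def
    by (intro isometric_isomorphism_comp[OF isometric_isomorphism_curry[OF e]]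
        isometric_isomorphism_bounded_operators dual isometric_isomorphism_dual_space_0[OF e])
  then have "(dual_space 1 :: ('a list \<Rightarrow> real) nspace)
      \<cong>\<^sub>n (bounded_operators real_line :: ('a \<Rightarrow> real) nspace)"
    unfolding isometrically_isomorphic_def
    by (intro conjI dual real_normed_space_bounded_operators[OF real_normed_space_real_line e])
      (rule exI)
  moreover have "(dual_space (Suc k) :: ('a list \<Rightarrow> real) nspace)
      \<cong>\<^sub>n (bounded_operators (dual_space k) :: ('a \<Rightarrow> 'a list \<Rightarrow> real) nspace)" for k
    unfolding isometrically_isomorphic_def
    by (intro conjI dual real_normed_space_bounded_operators[OF dual e])
      (rule exI, rule isometric_isomorphism_curry[OF e])
  then have "(dual_space n :: ('a list \<Rightarrow> real) nspace)
      \<cong>\<^sub>n (bounded_operators (dual_space (n - 1)) :: ('a \<Rightarrow> 'a list \<Rightarrow> real) nspace)"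
    using assms(1) by (metis Suc_diff_1 less_eq_Suc_le One_nat_def)
  ultimately show ?thesis by blast
qed

end
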